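(* (i) Let $f:\mathbb{R}\to\mathbb{R}$ be a function that is vertically rigid for an uncountable set $C\subset(0,\infty)$ via translations. If $f$ has at least one point of continuity, then there exist $a,b,k\in\mathbb{R}$ such that $f(x)=a+be^{kx}$ for all $x\in\mathbb{R}$. (ii) Let $f:\mathbb{R}\to\mathbb{R}$ be a function that is vertically rigid via translations for the set $C=(0,\infty)$. If $f$ is bounded on some nondegenerate interval, then there exist $a,b,k\in\mathbb{R}$ such that $f(x)=a+be^{kx}$ for all $x\in\mathbb{R}$.
   Context: For a function $h:\mathbb{R}\to\mathbb{R}$, $\mathrm{graph}(h)=\{(x,h(x)):x\in\mathbb{R}\}\subset\mathbb{R}^2$. For $C\subset(0,\infty)$, a function $f:\mathbb{R}\to\mathbb{R}$ is vertically rigid for $C$ via translations if for every $c\in C$ there exists a translation $\varphi$ of the plane $\mathbb{R}^2$ with $\varphi(\mathrm{graph}(cf))=\mathrm{graph}(f)$. *)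

theory Defs
  imports "HOL-Analysis.Analysis"
begin

(* The name graph is taken in Main by the graph of a partial map. *)
definition fun_graph :: "(real \<Rightarrow> real) \<Rightarrow> (real \<times> real) set"
  where "fun_graph h = {(x, h x) | x. x \<in> UNIV}"

definition plane_translation :: "(real \<times> real \<Rightarrow> real \<times> real) \<Rightarrow> bool"
  where "plane_translation \<phi> \<longleftrightarrow> (\<exists>t. \<forall>p. \<phi> p = p + t)"

(* Intended for C contained in {0<..}; theorems state this as a hypothesis. *)
definition vertically_rigid_via_translations :: "real set \<Rightarrow> (real \<Rightarrow> real) \<Rightarrow> bool"
  where "vertically_rigid_via_translations C f \<longleftrightarrow>
    (\<forall>c\<in>C. \<exists>\<phi>. plane_translation \<phi> \<and> \<phi> ` fun_graph (\<lambda>x. c * f x) = fun_graph f)"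

end

(* Rigidity for c gives f (x + u) = c * f x + v. For non-constant f the shift u determines
   the factor c, so the admissible shifts form an uncountable, hence dense, subgroup H of the
   reals, on which ln c is additive. Since f is bounded on some interval, ln c is bounded near 0 on H,
   and therefore c = exp (k * u). Comparing the two ways to shift by u + w gives
   v = a * (1 - exp (k * u)), so (f x - a) * exp (- k * x) is H-periodic. It is constant if f is
   continuous somewhere (H is dense), or if C = {0<..} (then H is the whole line). *)
theory Submission
  imports Defs
begin

section \<open>Uncountable subgroups of the real line\<close>

definition real_subgroup :: "real set \<Rightarrow> bool"
  where "real_subgroup H \<longleftrightarrow> 0 \<in> H \<and> (\<forall>u\<in>H. \<forall>w\<in>H. u - w \<in> H)"

lemma real_subgroup_minus: "real_subgroup H \<Longrightarrow> u \<in> H \<Longrightarrow> - u \<in> H"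
  unfolding real_subgroup_def by (metis diff_0)

lemma real_subgroup_add: "real_subgroup H \<Longrightarrow> u \<in> H \<Longrightarrow> w \<in> H \<Longrightarrow> u + w \<in> H"
  using real_subgroup_minus[of H w] unfolding real_subgroup_def
  by (metis diff_minus_eq_add)

lemma real_subgroup_of_nat_mult:
  assumes "real_subgroup H" "u \<in> H"
  shows "of_nat n * u \<in> H"
proof (induction n)
  case 0
  then show ?case using assms by (simp add: real_subgroup_def)
next
  case (Suc n)
  then show ?case
    using real_subgroup_add[OF assms(1) assms(2) Suc] by (simp add: algebra_simps)
qed

lemma real_subgroup_of_int_mult:
  assumes "real_subgroup H" "u \<in> H"
  shows "of_int m * u \<in> H"
  using real_subgroup_of_nat_mult[OF assms, of "nat \<bar>m\<bar>"]
    real_subgroup_minus[OF assms(1), of "of_nat (nat \<bar>m\<bar>) * u"]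
  by (cases "m \<ge> 0") auto

text \<open>Pigeonhole: only countably many cells of length \<open>e\<close> cover the line, so two
  elements of \<open>H\<close> share a cell, and their difference serves as
  \<open>d\<close>.\<close>

lemma uncountable_subgroup_small_element:
  assumes H: "real_subgroup H" "uncountable H" and "e > 0"
  obtains d where "d \<in> H" "0 < d" "d < e"
proof -
  have "\<not> inj_on (\<lambda>u. \<lfloor>u / e\<rfloor>) H"
    using assms(2) countableI'[of "\<lambda>u. \<lfloor>u / e\<rfloor>" H]
    by metis
  then obtain u w where uw: "u \<in> H" "w \<in> H" "u < w" "\<lfloor>u / e\<rfloor> = \<lfloor>w / e\<rfloor>"
    unfolding inj_on_def by (metis linorder_neqE_linordered_idom)
  have "w / e - u / e < 1"
    using uw(4) by linarith
  then have "w - u < e"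
    using \<open>e > 0\<close> by (simp add: field_simps)
  moreover have "w - u \<in> H"
    using H uw by (auto simp: real_subgroup_def)
  ultimately show ?thesis
    using uw(3) that by simp
qed

text \<open>The multiples of a small \<open>d\<close> in \<open>H\<close> form a grid of mesh below
  \<open>e\<close>; the grid point just below \<open>s\<close> is close enough.\<close>

lemma uncountable_subgroup_dense:
  assumes H: "real_subgroup H" "uncountable H" and "e > 0"
  obtains u where "u \<in> H" "\<bar>u - s\<bar> < e"
proof -
  obtain d where d: "d \<in> H" "0 < d" "d < e"
    using uncountable_subgroup_small_element[OF assms] .
  have "of_int \<lfloor>s / d\<rfloor> * d \<in> H"
    using real_subgroup_of_int_mult H d by blast
  moreover have "of_int \<lfloor>s / d\<rfloor> * d \<le> s" "s < (of_int \<lfloor>s / d\<rfloor> + 1) * d"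
    using floor_divide_lower[OF d(2)] floor_divide_upper[OF d(2)] by blast+
  then have "\<bar>of_int \<lfloor>s / d\<rfloor> * d - s\<bar> < e"
    using d by (simp add: algebra_simps)
  ultimately show ?thesis using that by blast
qed

section \<open>Additive functions on a subgroup\<close>

lemma additive_of_int_mult:
  fixes A :: "real \<Rightarrow> real"
  assumes H: "real_subgroup H"
    and add: "\<And>u w. u \<in> H \<Longrightarrow> w \<in> H \<Longrightarrow> A (u + w) = A u + A w"
    and u: "u \<in> H"
  shows "A (of_int m * u) = of_int m * A u"
proof -
  have 0: "A 0 = 0"
    using add[of 0 0] H by (simp add: real_subgroup_def)
  have nat: "A (of_nat n * u) = of_nat n * A u" for n
  proof (induction n)
    case (Suc n)
    then show ?case
      using add[OF u real_subgroup_of_nat_mult[OF H u, of n]] by (simp add: algebra_simps)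
  qed (simp add: 0)
  have neg: "A (- w) = - A w" if "w \<in> H" for w
    using add[OF that real_subgroup_minus[OF H that]] 0 by simp
  show ?thesis
  proof (cases "m \<ge> 0")
    case True
    then show ?thesis using nat[of "nat m"] by simp
  next
    case False
    then show ?thesis
      using nat[of "nat (- m)"] neg[OF real_subgroup_of_nat_mult[OF H u], of "nat (- m)"] by simp
  qed
qed

text \<open>A nonzero value would grow without bound along the multiples of
  \<open>u\<close>.\<close>

lemma additive_bounded_imp_zero:
  fixes A :: "real \<Rightarrow> real"
  assumes H: "real_subgroup H"
    and add: "\<And>u w. u \<in> H \<Longrightarrow> w \<in> H \<Longrightarrow> A (u + w) = A u + A w"
    and bnd: "\<And>u. u \<in> H \<Longrightarrow> \<bar>A u\<bar> \<le> B"
    and u: "u \<in> H"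
  shows "A u = 0"
proof (rule ccontr)
  assume nz: "A u \<noteq> 0"
  obtain n :: nat where "B < of_nat n * \<bar>A u\<bar>"
    using reals_Archimedean3[of "\<bar>A u\<bar>"] nz by auto
  moreover have "A (of_nat n * u) = of_nat n * A u"
    using additive_of_int_mult[OF H add u, of "int n"] by simp
  ultimately show False
    using bnd[OF real_subgroup_of_nat_mult[OF H u, of n]] by (simp add: abs_mult)
qed

text \<open>One small \<open>d\<close> in \<open>H\<close> fixes the slope; subtracting that linear
  function leaves an additive function that vanishes at \<open>d\<close> and turns out bounded,
  hence zero.\<close>

lemma additive_locally_bounded_imp_linear:
  fixes L :: "real \<Rightarrow> real"
  assumes H: "real_subgroup H" "uncountable H"
    and add: "\<And>u w. u \<in> H \<Longrightarrow> w \<in> H \<Longrightarrow> L (u + w) = L u + L w"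
    and "e > 0" and bnd: "\<And>u. u \<in> H \<Longrightarrow> \<bar>u\<bar> < e \<Longrightarrow> L u \<le> B"
  shows "\<exists>k. \<forall>u\<in>H. L u = k * u"
proof -
  obtain d where d: "d \<in> H" "0 < d" "d < e"
    using uncountable_subgroup_small_element[OF H \<open>e > 0\<close>] .
  define k where "k = L d / d"
  define A where "A u = L u - k * u" for u
  have A_add: "A (u + w) = A u + A w" if "u \<in> H" "w \<in> H" for u w
    using add[OF that] by (simp add: A_def algebra_simps)
  have "A d = 0"
    using d by (simp add: A_def k_def)
  have "L 0 = 0"
    using add[of 0 0] H by (simp add: real_subgroup_def)
  (* A is d-periodic, so its bound on [0, d) is a global bound. *)
  have bound: "\<bar>A u\<bar> \<le> B + \<bar>k\<bar> * e" if u: "u \<in> H" for u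
  proof -
    \<comment> \<open>The remainder of \<open>u\<close> modulo \<open>d\<close>, which lies in
      \<open>H\<close> and in [0, d).\<close>
    define r where "r = u + of_int (- \<lfloor>u / d\<rfloor>) * d"
    have md: "of_int (- \<lfloor>u / d\<rfloor>) * d \<in> H"
      using real_subgroup_of_int_mult[OF H(1) d(1)] .
    have "r \<in> H"
      using real_subgroup_add[OF H(1) u md] by (simp add: r_def)
    have "A r = A u"
      using A_add[OF u md] additive_of_int_mult[OF H(1) A_add d(1), of "- \<lfloor>u / d\<rfloor>"] \<open>A d = 0\<close>
      by (simp add: r_def)
    have "of_int \<lfloor>u / d\<rfloor> * d \<le> u" "u < (of_int \<lfloor>u / d\<rfloor> + 1) * d"
      using floor_divide_lower[OF d(2)] floor_divide_upper[OF d(2)] by blast+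
    then have "\<bar>r\<bar> < e"
      using d by (simp add: r_def algebra_simps)
    \<comment> \<open>Oddness of \<open>L\<close> turns the upper bound at \<open>- r\<close> into a
      lower bound at \<open>r\<close>.\<close>
    have "- r \<in> H"
      using real_subgroup_minus[OF H(1) \<open>r \<in> H\<close>] .
    have "L (- r) = - L r"
      using add[OF \<open>r \<in> H\<close> \<open>- r \<in> H\<close>] \<open>L 0 = 0\<close> by simp
    then have "\<bar>L r\<bar> \<le> B"
      using bnd[OF \<open>r \<in> H\<close>] bnd[OF \<open>- r \<in> H\<close>] \<open>\<bar>r\<bar> < e\<close> by simp
    moreover have "\<bar>k * r\<bar> \<le> \<bar>k\<bar> * e"
      using \<open>\<bar>r\<bar> < e\<close> by (simp add: abs_mult mult_left_mono)
    ultimately show ?thesis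
      using \<open>A r = A u\<close> abs_triangle_ineq4[of "L r" "k * r"] by (simp add: A_def)
  qed
  have "A u = 0" if "u \<in> H" for u
    using additive_bounded_imp_zero[OF H(1) A_add bound that] .
  then show ?thesis
    by (auto simp: A_def)
qed

section \<open>The functional equation of rigidity\<close>

text \<open>Says that the translation by \<open>(u, v)\<close> carries the graph of
  \<open>c * f\<close> onto that of \<open>f\<close>.\<close>

definition affine_shift :: "(real \<Rightarrow> real) \<Rightarrow> real \<Rightarrow> real \<Rightarrow> real \<Rightarrow> bool"
  where "affine_shift f u c v \<longleftrightarrow> c > 0 \<and> (\<forall>x. f (x + u) = c * f x + v)"

lemma rigid_imp_affine_shift:
  assumes "vertically_rigid_via_translations C f" "c \<in> C" "c > 0"
  shows "\<exists>u v. affine_shift f u c v"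
proof -
  obtain \<phi> where "plane_translation \<phi>" and \<phi>: "\<phi> ` fun_graph (\<lambda>x. c * f x) = fun_graph f"
    using assms unfolding vertically_rigid_via_translations_def by blast
  then obtain u v where t: "\<And>p. \<phi> p = p + (u, v)"
    unfolding plane_translation_def by (metis surj_pair)
  have "f (x + u) = c * f x + v" for x
  proof -
    have "\<phi> (x, c * f x) \<in> fun_graph f"
      using \<phi> by (auto simp: fun_graph_def)
    then show ?thesis
      by (simp add: t fun_graph_def)
  qed
  then show ?thesis
    using assms(3) by (auto simp: affine_shift_def)
qed

text \<open>Composition of two shifts. With \<open>affine_shift_minus\<close> it makes the
  admissible shifts a group on which factors multiply.\<close>

lemma affine_shift_add:
  assumes "affine_shift f u c v" "affine_shift f w d z"
  shows "affine_shift f (u + w) (c * d) (d * v + z)"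
  unfolding affine_shift_def
proof (intro conjI allI)
  fix x
  have "f ((x + u) + w) = d * f (x + u) + z" "f (x + u) = c * f x + v"
    using assms by (simp_all add: affine_shift_def)
  then show "f (x + (u + w)) = c * d * f x + (d * v + z)"
    by (simp add: algebra_simps)
qed (use assms in \<open>simp add: affine_shift_def\<close>)

lemma affine_shift_minus:
  assumes "affine_shift f u c v"
  shows "affine_shift f (- u) (1 / c) (- v / c)"
  unfolding affine_shift_def
proof (intro conjI allI)
  fix x
  have "c > 0" and shift: "\<And>y. f (y + u) = c * f y + v"
    using assms by (simp_all add: affine_shift_def)
  then show "f (x + - u) = 1 / c * f x + - v / c"
    using shift[of "x - u"] by (simp add: field_simps)
qed (use assms in \<open>simp add: affine_shift_def\<close>)

text \<open>Taking the difference of the values at \<open>p + u\<close> and \<open>q + u\<close>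
  cancels the additive term.\<close>

lemma affine_shift_unique:
  assumes "affine_shift f u c v" "affine_shift f u d z" "f p \<noteq> f q"
  shows "c = d"
proof -
  have "c * (f p - f q) = d * (f p - f q)"
    using assms(1,2) unfolding affine_shift_def
    by (metis add_diff_cancel_right right_diff_distrib)
  then show ?thesis
    using assms(3) by simp
qed

section \<open>Exponential form of the factors\<close>

text \<open>Common core of both halves of the theorem: a point of continuity and an interval of
  boundedness each supply the bound near \<open>x0\<close>.\<close>

lemma rigid_shift_structure:
  assumes C: "C \<subseteq> {0<..}" "uncountable C"
    and rigid: "vertically_rigid_via_translations C f"
    and nonconst: "f p \<noteq> f q"
    and "e > 0" and bnd: "\<And>x. \<bar>x - x0\<bar> < e \<Longrightarrow> \<bar>f x\<bar> \<le> M"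
  obtains H a k where "real_subgroup H" "uncountable H" "k \<noteq> 0"
    "\<And>u x. u \<in> H \<Longrightarrow> f (x + u) = a + exp (k * u) * (f x - a)"
    "\<And>c. c \<in> C \<Longrightarrow> \<exists>u\<in>H. exp (k * u) = c"
proof -
  define H where "H = {u. \<exists>c v. affine_shift f u c v}"
  have "\<forall>u\<in>H. \<exists>c v. affine_shift f u c v"
    by (simp add: H_def)
  then obtain m v where mv: "\<And>u. u \<in> H \<Longrightarrow> affine_shift f u (m u) (v u)"
    by metis
  \<comment> \<open>Any shift equation derived later thus reveals a value of \<open>m\<close>; this
    gives multiplicativity.\<close>
  have m_eq: "u \<in> H \<and> m u = c" if "affine_shift f u c z" for u c z
  proof -
    have "u \<in> H" using that by (auto simp: H_def)
    then show ?thesis using affine_shift_unique[OF mv that nonconst] by blast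
  qed
  have "affine_shift f 0 1 0"
    by (simp add: affine_shift_def)
  then have zero: "0 \<in> H"
    by (auto simp: H_def)
  have diff: "u - w \<in> H" if "u \<in> H" "w \<in> H" for u w
    using m_eq[OF affine_shift_add[OF mv[OF that(1)] affine_shift_minus[OF mv[OF that(2)]]]]
    by simp
  have H: "real_subgroup H"
    using zero diff by (simp add: real_subgroup_def)
  have C_m: "\<exists>u\<in>H. m u = c" if "c \<in> C" for c
    using rigid_imp_affine_shift[OF rigid that] C(1) that m_eq by fastforce
  then have "C \<subseteq> m ` H"
    by blast
  then have unc: "uncountable H"
    using C(2) by (meson countable_image countable_subset)
  have m_pos: "m u > 0" if "u \<in> H" for u
    using mv[OF that] by (simp add: affine_shift_def)
  have m_add: "m (u + w) = m u * m w" if "u \<in> H" "w \<in> H" for u w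
    using m_eq[OF affine_shift_add[OF mv[OF that(1)] mv[OF that(2)]]] by blast
  \<comment> \<open>By density some shift in \<open>H\<close> carries a neighbourhood of
    \<open>x0\<close> over \<open>y\<close>; one half of \<open>e\<close> pays for the inexact
    shift, the other for the distance from \<open>y\<close>.\<close>
  have locally_bounded: "\<exists>K. \<forall>x. \<bar>x - y\<bar> < e / 2 \<longrightarrow> \<bar>f x\<bar> \<le> K" for y
  proof -
    obtain u where u: "u \<in> H" "\<bar>u - (y - x0)\<bar> < e / 2"
      using uncountable_subgroup_dense[OF H unc, of "e / 2" "y - x0"] \<open>e > 0\<close> by auto
    have "\<bar>f x\<bar> \<le> m u * M + \<bar>v u\<bar>" if "\<bar>x - y\<bar> < e / 2" for x
    proof -
      have "\<bar>(x - u) - x0\<bar> < e"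
        using u that by linarith
      then have "\<bar>m u * f (x - u)\<bar> \<le> m u * M"
        using bnd m_pos[OF u(1)] by (simp add: abs_mult)
      moreover have "f x = m u * f (x - u) + v u"
        using mv[OF u(1)] unfolding affine_shift_def by (metis diff_add_cancel)
      ultimately show ?thesis
        using abs_triangle_ineq[of "m u * f (x - u)" "v u"] by linarith
    qed
    then show ?thesis by blast
  qed
  obtain P where P: "\<And>x. \<bar>x - p\<bar> < e / 2 \<Longrightarrow> \<bar>f x\<bar> \<le> P"
    using locally_bounded by blast
  obtain Q where Q: "\<And>x. \<bar>x - q\<bar> < e / 2 \<Longrightarrow> \<bar>f x\<bar> \<le> Q"
    using locally_bounded by blast
  \<comment> \<open>The factor is the quotient of \<open>f (p + u) - f (q + u)\<close> by
    \<open>f p - f q\<close>, whose numerator is bounded for small \<open>u\<close>.\<close>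
  have "m u \<le> (P + Q) / \<bar>f p - f q\<bar>" if u: "u \<in> H" "\<bar>u\<bar> < e / 2" for u
  proof -
    have "f (p + u) - f (q + u) = m u * (f p - f q)"
      using mv[OF u(1)] by (simp add: affine_shift_def algebra_simps)
    then have "m u * \<bar>f p - f q\<bar> = \<bar>f (p + u) - f (q + u)\<bar>"
      using m_pos[OF u(1)] by (simp add: abs_mult)
    also have "\<dots> \<le> P + Q"
      using P[of "p + u"] Q[of "q + u"] u(2) by simp
    finally show ?thesis
      using nonconst by (simp add: field_simps)
  qed
  \<comment> \<open>The same bound survives because ln t \<le> t for t > 0.\<close>
  then have "ln (m u) \<le> (P + Q) / \<bar>f p - f q\<bar>" if "u \<in> H" "\<bar>u\<bar> < e / 2" for u
    using that m_pos ln_bound[of "m u"] by fastforce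
  moreover have "ln (m (u + w)) = ln (m u) + ln (m w)" if "u \<in> H" "w \<in> H" for u w
    using m_add[OF that] m_pos[OF that(1)] m_pos[OF that(2)] by (simp add: ln_mult_pos)
  ultimately obtain k where k: "\<And>u. u \<in> H \<Longrightarrow> ln (m u) = k * u"
    using additive_locally_bounded_imp_linear[OF H unc, of "\<lambda>u. ln (m u)" "e / 2"] \<open>e > 0\<close>
    by (metis half_gt_zero)
  have m_exp: "m u = exp (k * u)" if "u \<in> H" for u
    using k[OF that] m_pos[OF that] by (metis exp_ln)
  have C_exp: "\<exists>u\<in>H. exp (k * u) = c" if "c \<in> C" for c
    using C_m[OF that] m_exp by metis
  \<comment> \<open>A factor other than 1 is needed to have \<open>k \<noteq> 0\<close> and to
    define \<open>a\<close>.\<close>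
  have "\<not> C \<subseteq> {1}"
    using C(2) countable_subset[of C "{1}"] by auto
  then obtain w where w: "w \<in> H" "exp (k * w) \<noteq> 1"
    using C_exp by (metis insertCI subsetI)
  then have "k \<noteq> 0"
    by auto
  \<comment> \<open>The fixed point of the map t -> \<open>exp (k * w) * t + v w\<close> that the
    shift by \<open>w\<close> induces on values.\<close>
  define a where "a = v w / (1 - exp (k * w))"
  have "f (x + u) = a + exp (k * u) * (f x - a)" if u: "u \<in> H" for u x
  proof -
    have fu: "f (y + u) = exp (k * u) * f y + v u" for y
      using mv[OF u] m_exp[OF u] by (simp add: affine_shift_def)
    have fw: "f (y + w) = exp (k * w) * f y + v w" for y
      using mv[OF w(1)] m_exp[OF w(1)] by (simp add: affine_shift_def)
    \<comment> \<open>The value maps of \<open>u\<close> and \<open>w\<close> commute at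
      \<open>f x\<close>; comparing constants shows that \<open>a\<close> is fixed by the map of
      \<open>u\<close> as well.\<close>
    have "f ((x + u) + w) = f ((x + w) + u)"
      by (simp add: ac_simps)
    then have "exp (k * w) * v u + v w = exp (k * u) * v w + v u"
      unfolding fu fw by (simp add: algebra_simps)
    then have "v u * (1 - exp (k * w)) = v w * (1 - exp (k * u))"
      by (simp add: algebra_simps)
    then have "v u = a * (1 - exp (k * u))"
      using w(2) by (simp add: a_def field_simps)
    then show ?thesis
      unfolding fu by (simp add: algebra_simps)
  qed
  then show ?thesis
    using that[OF H unc \<open>k \<noteq> 0\<close>] C_exp by blast
qed

section \<open>From local regularity to the exponential formula\<close>

lemma continuous_at_bounded_near:
  fixes f :: "real \<Rightarrow> real"
  assumes "isCont f x0"
  obtains e M where "e > 0" "\<And>x. \<bar>x - x0\<bar> < e \<Longrightarrow> \<bar>f x\<bar> \<le> M"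
proof -
  obtain e where e: "e > 0" "\<And>x. dist x x0 < e \<Longrightarrow> dist (f x) (f x0) < 1"
    using assms unfolding continuous_at_eps_delta by (metis zero_less_one)
  have "\<bar>f x\<bar> \<le> \<bar>f x0\<bar> + 1" if "\<bar>x - x0\<bar> < e" for x
    using e(2)[of x] that by (simp add: dist_real_def)
  then show ?thesis using that e(1) by blast
qed

lemma bounded_on_interval_bounded_near:
  fixes f :: "real \<Rightarrow> real"
  assumes "is_interval I" "u \<in> I" "v \<in> I" "u < v" "bounded (f ` I)"
  obtains x0 e M where "e > 0" "\<And>x. \<bar>x - x0\<bar> < e \<Longrightarrow> \<bar>f x\<bar> \<le> M"
proof -
  obtain M where M: "\<And>x. x \<in> I \<Longrightarrow> \<bar>f x\<bar> \<le> M"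
    using assms(5) by (auto simp: bounded_iff)
  have "x \<in> I" if "\<bar>x - (u + v) / 2\<bar> < (v - u) / 2" for x
  proof (rule mem_is_interval_1_I[OF assms(1-3)])
    show "u \<le> x" "x \<le> v"
      using that by (auto simp: abs_if field_simps split: if_splits)
  qed
  then show ?thesis
    using that[of "(v - u) / 2" "(u + v) / 2" M] M assms(4) by simp
qed

lemma rigid_continuous_at_point:
  fixes f :: "real \<Rightarrow> real"
  assumes C: "C \<subseteq> {0<..}" "uncountable C" "vertically_rigid_via_translations C f"
    and cont: "isCont f x0"
  shows "\<exists>a b k. \<forall>x. f x = a + b * exp (k * x)"
proof (cases "\<exists>p q. f p \<noteq> f q")
  case False
  then have "\<forall>x. f x = f 0 + 0 * exp (0 * x)" by auto
  then show ?thesis by blast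
next
  case True
  then obtain p q where pq: "f p \<noteq> f q" by blast
  obtain e M where e: "e > 0" "\<And>x. \<bar>x - x0\<bar> < e \<Longrightarrow> \<bar>f x\<bar> \<le> M"
    using continuous_at_bounded_near[OF cont] by blast
  obtain H a k where H: "real_subgroup H" "uncountable H"
    and shift: "\<And>u x. u \<in> H \<Longrightarrow> f (x + u) = a + exp (k * u) * (f x - a)"
    using rigid_shift_structure[OF C pq e] by metis
  \<comment> \<open>Dividing out the expected exponential turns the shift rule into periodicity; the
    goal becomes that \<open>h\<close> is constant.\<close>
  define h where "h x = (f x - a) * exp (- k * x)" for x
  have periodic: "h (x + u) = h x" if "u \<in> H" for x u
  proof -
    have "h (x + u) = (f x - a) * (exp (k * u) * exp (- k * (x + u)))"
      by (simp add: h_def shift[OF that])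
    also have "exp (k * u) * exp (- k * (x + u)) = exp (- k * x)"
      by (simp add: algebra_simps flip: exp_add)
    finally show ?thesis
      by (simp add: h_def)
  qed
  have h_cont: "isCont h x0"
    unfolding h_def using cont by (intro continuous_intros)
  have const: "h y = h x0" for y
  proof (rule ccontr)
    assume "h y \<noteq> h x0"
    \<comment> \<open>Continuity is used with tolerance \<open>dist (h y) (h x0)\<close>: by density
      \<open>h\<close> takes the value \<open>h y\<close> at some \<open>y + u\<close> within
      \<open>d\<close> of \<open>x0\<close>, a contradiction.\<close>
    then obtain d where d: "d > 0" "\<And>x. dist x x0 < d \<Longrightarrow> dist (h x) (h x0) < dist (h y) (h x0)"
      using h_cont unfolding continuous_at_eps_delta by (metis zero_less_dist_iff)
    obtain u where "u \<in> H" "\<bar>u - (x0 - y)\<bar> < d"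
      using uncountable_subgroup_dense[OF H d(1)] .
    then show False
      using d(2)[of "y + u"] periodic[of u y] by (simp add: dist_real_def algebra_simps)
  qed
  have "f x = a + h x0 * exp (k * x)" for x
    unfolding const[of x, symmetric] by (simp add: h_def mult.assoc flip: exp_add)
  then show ?thesis by blast
qed

text \<open>Here every positive number is a factor, so all reals are admissible shifts and the orbit
  of the single point 0 already gives the formula.\<close>

lemma rigid_bounded_near_point:
  fixes f :: "real \<Rightarrow> real"
  assumes rigid: "vertically_rigid_via_translations {0<..} f"
    and e: "e > 0" "\<And>x. \<bar>x - x0\<bar> < e \<Longrightarrow> \<bar>f x\<bar> \<le> M"
  shows "\<exists>a b k. \<forall>x. f x = a + b * exp (k * x)"
proof (cases "\<exists>p q. f p \<noteq> f q")
  case False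
  then have "\<forall>x. f x = f 0 + 0 * exp (0 * x)" by auto
  then show ?thesis by blast
next
  case True
  then obtain p q where pq: "f p \<noteq> f q" by blast
  have "{0<..<1} \<subseteq> ({0<..} :: real set)" "uncountable {0<..<1::real}"
    by (auto simp: uncountable_open_interval)
  then have "uncountable ({0<..} :: real set)"
    using countable_subset by blast
  then obtain H a k where k: "k \<noteq> 0"
    and shift: "\<And>u x. u \<in> H \<Longrightarrow> f (x + u) = a + exp (k * u) * (f x - a)"
    and onto: "\<And>c. c \<in> {0<..} \<Longrightarrow> \<exists>u\<in>H. exp (k * u) = c"
    using rigid_shift_structure[OF subset_refl _ rigid pq e] by metis
  \<comment> \<open>The shift with factor \<open>exp (k * x)\<close> must be \<open>x\<close>
    itself, as \<open>exp\<close> is injective and \<open>k \<noteq> 0\<close>.\<close>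
  have "x \<in> H" for x
    using onto[of "exp (k * x)"] k by auto
  then have "f x = a + (f 0 - a) * exp (k * x)" for x
    using shift[of x 0] by (simp add: mult.commute)
  then show ?thesis by blast
qed

theorem theorem2p8:
  shows "(\<forall>(f :: real \<Rightarrow> real) (C :: real set).
            C \<subseteq> {0<..} \<longrightarrow> uncountable C \<longrightarrow>
            vertically_rigid_via_translations C f \<longrightarrow>
            (\<exists>x0. isCont f x0) \<longrightarrow>
            (\<exists>a b k :: real. \<forall>x. f x = a + b * exp (k * x)))
       \<and> (\<forall>f :: real \<Rightarrow> real.
            vertically_rigid_via_translations {0<..} f \<longrightarrow>
            (\<exists>I. is_interval I \<and> (\<exists>u\<in>I. \<exists>v\<in>I. u \<noteq> v) \<and> bounded (f ` I)) \<longrightarrow>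
            (\<exists>a b k :: real. \<forall>x. f x = a + b * exp (k * x)))"
proof (intro conjI allI impI)
  fix f :: "real \<Rightarrow> real" and C :: "real set"
  assume "C \<subseteq> {0<..}" "uncountable C" "vertically_rigid_via_translations C f" "\<exists>x0. isCont f x0"
  then show "\<exists>a b k. \<forall>x. f x = a + b * exp (k * x)"
    using rigid_continuous_at_point by blast
next
  fix f :: "real \<Rightarrow> real"
  assume rigid: "vertically_rigid_via_translations {0<..} f"
    and "\<exists>I. is_interval I \<and> (\<exists>u\<in>I. \<exists>v\<in>I. u \<noteq> v) \<and> bounded (f ` I)"
  then obtain I u v where "is_interval I" "u \<in> I" "v \<in> I" "u < v" "bounded (f ` I)"
    by (metis linorder_neqE_linordered_idom)
  then show "\<exists>a b k. \<forall>x. f x = a + b * exp (k * x)"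
    using bounded_on_interval_bounded_near rigid_bounded_near_point[OF rigid] by metis
qed

end
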